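(* Consider the algorithm D--NC with constant step-size $0<\alpha\le 1/(2L)$ on the problem of minimizing $f=\sum_{i=1}^N f_i$ over $\mathbb{R}^d$, where the weight matrix $W$ satisfies $0<\mu:=\mu(W)<1$; $f$ has a minimizer $x^\star$, $f^\star=f(x^\star)$; every $f_i:\mathbb{R}^d\to\mathbb{R}$ is convex and differentiable with $L$-Lipschitz continuous gradient; $\|\nabla f_i(x)\|\le G$ for all $x$ and $i$; and $\|\overline{x}(0)-x^\star\|\le R$. Let $\xi\in(0,1)$ be arbitrary. Then, after $k\geq 1$ outer iterations and the corresponding $\mathcal{K}=\sum_{t=1}^k(\tau_x(t)+\tau_y(t))$ communication rounds, at any node $i$, the quantity $\frac1N\left(f(x_i(k))-f^\star\right)$ is $$O\left(\frac{1}{\left((1-\mu)\mathcal{K}^{1-\xi}\right)^2}+\frac{\sqrt{N}}{\left((1-\mu)\mathcal{K}^{1-\xi}\right)^3}+\frac{N}{\left((1-\mu)\mathcal{K}^{1-\xi}\right)^4}\right)\quad\text{and}\quad O\left(\frac{1}{k^2}+\frac{N^{1/2}}{k^3}+\frac{N}{k^4}\right).$$ Here each $O(\cdot)$ bound means: there is a finite constant depending only on $L,G,R,\alpha,\xi$, but not on $N$, the graph, $W$, or $k$, such that the quantity is at most this constant times the expression inside $O(\cdot)$.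
   Context: Network: $N\ge 2$ nodes; $\mathcal{G}=(\mathcal{N},E)$ is a connected, undirected, simple graph on them. $W$ is a symmetric doubly stochastic $N\times N$ matrix with, for $i\ne j$, $W_{ij}>0$ if and only if $\{i,j\}\in E$. $J=\frac1N\mathbf{1}\mathbf{1}^\top$, and $\mu(W)=\|W-J\|$ (spectral norm) is the second largest singular value of $W$. $\|\cdot\|$ is the Euclidean norm for vectors; $1/(2L)$ is read as $+\infty$ if $L=0$. Algorithm D--NC: each node $i$ holds $x_i(k),y_i(k)\in\mathbb{R}^d$; stack $x(k)=(x_1(k)^\top,\dots,x_N(k)^\top)^\top$, $y(k)=(y_1(k)^\top,\dots,y_N(k)^\top)^\top$, and let $\nabla F(y)=(\nabla f_1(y_1)^\top,\dots,\nabla f_N(y_N)^\top)^\top$. All nodes start from a common point: $x_i(0)=y_i(0)=x_j(0)=y_j(0)$ for all $i,j$. For outer iterations $k=1,2,\dots$ $$x(k)=(W\otimes I)^{\tau_x(k)}\left[y(k-1)-\alpha\nabla F(y(k-1))\right],$$ $$y(k)=(W\otimes I)^{\tau_y(k)}\left[x(k)+\beta_{k-1}(x(k)-x(k-1))\right],$$ where $I$ is the $d\times d$ identity, $\beta_k=\frac{k}{k+3}$, and $$\tau_x(k)=\left\lceil\frac{2\log k}{-\log\mu(W)}\right\rceil,\qquad \tau_y(k)=\left\lceil\frac{\log 3}{-\log\mu(W)}+\frac{2\log k}{-\log\mu(W)}\right\rceil .$$ Each multiplication by $W\otimes I$ is one communication round, so outer iteration $k$ uses $\tau_x(k)+\tau_y(k)$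 communication rounds. Further $\overline{x}(k)=\frac1N\sum_{i=1}^N x_i(k)$. *)

theory Defs
  imports "HOL-Analysis.Analysis" "HOL-Library.Poly_Mapping"
begin

text \<open>
  The constants in the theorem may not depend on the dimension \<open>d\<close>, so \<open>d\<close> has to be quantified
  inside the statement and cannot be a type. All spaces \<open>\<real>\<^sup>d\<close> are therefore taken as subspaces of one
  type, the finitely supported real sequences, which carries the Euclidean inner product.
\<close>

instantiation poly_mapping :: (type, real_vector) real_vector
begin

lift_definition scaleR_poly_mapping :: "real \<Rightarrow> ('a \<Rightarrow>\<^sub>0 'b) \<Rightarrow> 'a \<Rightarrow>\<^sub>0 'b"
  is "\<lambda>c p k. c *\<^sub>R p k"
proof -
  fix c :: real and p :: "'a \<Rightarrow> 'b"
  assume "finite {k. p k \<noteq> 0}"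
  moreover have "{k. c *\<^sub>R p k \<noteq> 0} \<subseteq> {k. p k \<noteq> 0}" by auto
  ultimately show "finite {k. c *\<^sub>R p k \<noteq> 0}" by (rule finite_subset[rotated])
qed

instance
  by standard
    (transfer, simp add: scaleR_add_right scaleR_add_left fun_eq_iff)+

end

instantiation poly_mapping :: (type, real_inner) real_inner
begin

definition inner_poly_mapping :: "('a \<Rightarrow>\<^sub>0 'b) \<Rightarrow> ('a \<Rightarrow>\<^sub>0 'b) \<Rightarrow> real"
  where "inner_poly_mapping p q = (\<Sum>k\<in>Poly_Mapping.keys p. Poly_Mapping.lookup p k \<bullet> Poly_Mapping.lookup q k)"

definition norm_poly_mapping :: "('a \<Rightarrow>\<^sub>0 'b) \<Rightarrow> real"
  where "norm_poly_mapping p = sqrt (p \<bullet> p)"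

definition sgn_poly_mapping :: "('a \<Rightarrow>\<^sub>0 'b) \<Rightarrow> 'a \<Rightarrow>\<^sub>0 'b"
  where "sgn_poly_mapping p = p /\<^sub>R norm p"

definition dist_poly_mapping :: "('a \<Rightarrow>\<^sub>0 'b) \<Rightarrow> ('a \<Rightarrow>\<^sub>0 'b) \<Rightarrow> real"
  where "dist_poly_mapping p q = norm (p - q)"

definition uniformity_poly_mapping :: "(('a \<Rightarrow>\<^sub>0 'b) \<times> ('a \<Rightarrow>\<^sub>0 'b)) filter"
  where "uniformity_poly_mapping = (INF e\<in>{0 <..}. principal {(p, q). dist p q < e})"

definition open_poly_mapping :: "('a \<Rightarrow>\<^sub>0 'b) set \<Rightarrow> bool"
  where "open_poly_mapping U \<longleftrightarrow> (\<forall>p\<in>U. \<forall>\<^sub>F (p', q) in uniformity. p' = p \<longrightarrow> q \<in> U)"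

lemma inner_poly_mapping_superset:
  assumes "finite A" and "Poly_Mapping.keys p \<subseteq> A"
  shows "p \<bullet> q = (\<Sum>k\<in>A. Poly_Mapping.lookup p k \<bullet> Poly_Mapping.lookup q k)"
  unfolding inner_poly_mapping_def
  using assms by (intro sum.mono_neutral_left) (auto simp: in_keys_iff)

lemma lookup_scaleR: "Poly_Mapping.lookup (c *\<^sub>R p) k = c *\<^sub>R Poly_Mapping.lookup p k"
  by transfer simp

instance
proof
  fix p q s :: "'a \<Rightarrow>\<^sub>0 'b" and c :: real
  let ?A = "Poly_Mapping.keys p \<union> Poly_Mapping.keys q \<union> Poly_Mapping.keys s"
  have fin: "finite ?A" by simp
  have P: "p \<bullet> r = (\<Sum>k\<in>?A. Poly_Mapping.lookup p k \<bullet> Poly_Mapping.lookup r k)" for r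
    by (rule inner_poly_mapping_superset) auto
  have Q: "q \<bullet> r = (\<Sum>k\<in>?A. Poly_Mapping.lookup q k \<bullet> Poly_Mapping.lookup r k)" for r
    by (rule inner_poly_mapping_superset) auto
  have PQ: "(p + q) \<bullet> r = (\<Sum>k\<in>?A. Poly_Mapping.lookup (p + q) k \<bullet> Poly_Mapping.lookup r k)" for r
    by (rule inner_poly_mapping_superset) (use keys_add[of p q] in auto)
  have CP: "(c *\<^sub>R p) \<bullet> r = (\<Sum>k\<in>?A. Poly_Mapping.lookup (c *\<^sub>R p) k \<bullet> Poly_Mapping.lookup r k)" for r
    by (rule inner_poly_mapping_superset) (auto simp: in_keys_iff lookup_scaleR)
  show "p \<bullet> q = q \<bullet> p"
    unfolding P Q by (simp add: inner_commute)
  show "(p + q) \<bullet> s = p \<bullet> s + q \<bullet> s"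
    unfolding P Q PQ by (simp add: lookup_add inner_add_left sum.distrib)
  show "(c *\<^sub>R p) \<bullet> q = c * (p \<bullet> q)"
    unfolding P CP by (simp add: lookup_scaleR sum_distrib_left)
  show "0 \<le> p \<bullet> p"
    unfolding inner_poly_mapping_def by (simp add: sum_nonneg)
  show "p \<bullet> p = 0 \<longleftrightarrow> p = 0"
    unfolding inner_poly_mapping_def
    by (subst sum_nonneg_eq_0_iff) (auto simp: in_keys_iff poly_mapping_eq_iff fun_eq_iff)
qed (simp_all add: norm_poly_mapping_def sgn_poly_mapping_def dist_poly_mapping_def
    uniformity_poly_mapping_def open_poly_mapping_def)

end

type_synonym rvec = "nat \<Rightarrow>\<^sub>0 real"

definition Rn :: "nat \<Rightarrow> rvec set"
  where "Rn d = {v. \<forall>l\<ge>d. Poly_Mapping.lookup v l = 0}"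

text \<open>
  The gradient is required to lie in \<open>Rn d\<close>, which makes it unique: a derivative within \<open>Rn d\<close>
  only determines its component in \<open>Rn d\<close>.
\<close>

definition is_gradient_on :: "nat \<Rightarrow> (rvec \<Rightarrow> real) \<Rightarrow> (rvec \<Rightarrow> rvec) \<Rightarrow> bool"
  where "is_gradient_on d f g \<longleftrightarrow>
    (\<forall>v\<in>Rn d. g v \<in> Rn d \<and> (f has_derivative (\<lambda>h. g v \<bullet> h)) (at v within Rn d))"

text \<open>
  The nodes are the numbers below \<open>N\<close>; matrices and stacked vectors are functions whose values at
  indices outside this range are irrelevant. Edges are two-element sets of nodes.
\<close>

definition simple_graph :: "nat \<Rightarrow> nat set set \<Rightarrow> bool"
  where "simple_graph N E \<longleftrightarrow> (\<forall>e\<in>E. e \<subseteq> {..<N} \<and> card e = 2)"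

definition connected_graph :: "nat \<Rightarrow> nat set set \<Rightarrow> bool"
  where "connected_graph N E \<longleftrightarrow> (\<forall>i<N. \<forall>j<N. (i, j) \<in> {(u, v). {u, v} \<in> E}\<^sup>*)"

definition symmetric_matrix :: "nat \<Rightarrow> (nat \<Rightarrow> nat \<Rightarrow> real) \<Rightarrow> bool"
  where "symmetric_matrix N W \<longleftrightarrow> (\<forall>i<N. \<forall>j<N. W i j = W j i)"

definition doubly_stochastic :: "nat \<Rightarrow> (nat \<Rightarrow> nat \<Rightarrow> real) \<Rightarrow> bool"
  where "doubly_stochastic N W \<longleftrightarrow>
    (\<forall>i<N. \<forall>j<N. 0 \<le> W i j) \<and>
    (\<forall>i<N. (\<Sum>j<N. W i j) = 1) \<and>
    (\<forall>j<N. (\<Sum>i<N. W i j) = 1)"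

definition weight_matrix :: "nat \<Rightarrow> nat set set \<Rightarrow> (nat \<Rightarrow> nat \<Rightarrow> real) \<Rightarrow> bool"
  where "weight_matrix N E W \<longleftrightarrow>
    symmetric_matrix N W \<and> doubly_stochastic N W \<and>
    (\<forall>i<N. \<forall>j<N. i \<noteq> j \<longrightarrow> (0 < W i j \<longleftrightarrow> {i, j} \<in> E))"

definition spectral_norm :: "nat \<Rightarrow> (nat \<Rightarrow> nat \<Rightarrow> real) \<Rightarrow> real"
  where "spectral_norm N A =
    (SUP v\<in>{v. L2_set v {..<N} = 1}. L2_set (\<lambda>i. \<Sum>j<N. A i j * v j) {..<N})"

definition mu :: "nat \<Rightarrow> (nat \<Rightarrow> nat \<Rightarrow> real) \<Rightarrow> real"
  where "mu N W = spectral_norm N (\<lambda>i j. W i j - 1 / real N)"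

definition tau_x :: "real \<Rightarrow> nat \<Rightarrow> nat"
  where "tau_x m k = nat \<lceil>2 * ln (real k) / (- ln m)\<rceil>"

definition tau_y :: "real \<Rightarrow> nat \<Rightarrow> nat"
  where "tau_y m k = nat \<lceil>ln 3 / (- ln m) + 2 * ln (real k) / (- ln m)\<rceil>"

definition comm_rounds :: "real \<Rightarrow> nat \<Rightarrow> nat"
  where "comm_rounds m k = (\<Sum>t = 1..k. tau_x m t + tau_y m t)"

definition beta :: "nat \<Rightarrow> real"
  where "beta k = real k / (real k + 3)"

text \<open>Multiplication of a stacked vector by \<open>W \<otimes> I\<close>, written blockwise.\<close>

definition mix :: "nat \<Rightarrow> (nat \<Rightarrow> nat \<Rightarrow> real) \<Rightarrow> (nat \<Rightarrow> rvec) \<Rightarrow> nat \<Rightarrow> rvec"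
  where "mix N W x i = (\<Sum>j<N. W i j *\<^sub>R x j)"

text \<open>In \<open>dnc_run\<close>, \<open>x k i\<close> and \<open>y k i\<close> are the iterates of node \<open>i\<close> after \<open>k\<close> outer iterations.\<close>

definition dnc_run ::
  "nat \<Rightarrow> (nat \<Rightarrow> nat \<Rightarrow> real) \<Rightarrow> nat \<Rightarrow> (nat \<Rightarrow> rvec \<Rightarrow> rvec) \<Rightarrow> real \<Rightarrow>
   (nat \<Rightarrow> nat \<Rightarrow> rvec) \<Rightarrow> (nat \<Rightarrow> nat \<Rightarrow> rvec) \<Rightarrow> bool"
  where "dnc_run N W d grad \<alpha> x y \<longleftrightarrow>
    (\<exists>x0\<in>Rn d. \<forall>i<N. x 0 i = x0 \<and> y 0 i = x0) \<and>
    (\<forall>k\<ge>1. \<forall>i<N.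
      x k i = (mix N W ^^ tau_x (mu N W) k)
                (\<lambda>j. y (k - 1) j - \<alpha> *\<^sub>R grad j (y (k - 1) j)) i \<and>
      y k i = (mix N W ^^ tau_y (mu N W) k)
                (\<lambda>j. x k j + beta (k - 1) *\<^sub>R (x k j - x (k - 1) j)) i)"

definition node_average :: "nat \<Rightarrow> (nat \<Rightarrow> rvec) \<Rightarrow> rvec"
  where "node_average N x = (1 / real N) *\<^sub>R (\<Sum>i<N. x i)"

definition total_cost :: "nat \<Rightarrow> (nat \<Rightarrow> rvec \<Rightarrow> real) \<Rightarrow> rvec \<Rightarrow> real"
  where "total_cost N f z = (\<Sum>j<N. f j z)"

definition rate_bound :: "nat \<Rightarrow> real \<Rightarrow> real"
  where "rate_bound N s = 1 / s ^ 2 + sqrt (real N) / s ^ 3 + real N / s ^ 4"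

end

theory Submission
  imports Defs
begin

text \<open>
  Since \<open>W\<close> is doubly stochastic, the node averages follow Nesterov's method for \<open>f / N\<close> with an
  inexact gradient, whose error per step is controlled by \<open>L / (2 N)\<close> times the squared disagreement
  of the \<open>y\<^sub>i\<close>. The numbers of consensus steps are chosen so that mixing contracts disagreements by
  \<open>1 / k\<^sup>2\<close> and \<open>1 / (3 k\<^sup>2)\<close>; with gradients bounded by \<open>G\<close> the disagreements stay below
  \<open>B = \<alpha> G \<surd>N\<close> and hence decay like \<open>B / k\<^sup>2\<close>. The errors, weighted by \<open>k\<^sup>2\<close> in Nesterov's
  potential, are therefore summable, uniformly in \<open>N\<close>. Passing from the average to a node costs a
  term of order \<open>B\<^sup>2 / k\<^sup>4\<close> by smoothness. Finally \<open>(1 - \<mu>) \<K> = O(k (1 + ln k))\<close>, so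
  \<open>(1 - \<mu>) \<K>\<^sup>1\<^sup>-\<^sup>\<xi> = O(k)\<close>, which turns the bound in \<open>k\<close> into the bound in \<open>\<K>\<close>.
\<close>

section \<open>Smooth convex functions on a subspace\<close>

lemma subspace_Rn: "subspace (Rn d)"
  by (auto simp: subspace_def Rn_def lookup_add lookup_scaleR)

text \<open>The whole line through \<open>v\<close> in direction \<open>h\<close> stays in
  \<open>S\<close>, so the derivative within \<open>S\<close> suffices for the chain rule and yields
  an unrestricted one-variable derivative.\<close>

lemma gradient_along_line:
  fixes f :: "'a::real_inner \<Rightarrow> real"
  assumes "subspace S" "v \<in> S" "h \<in> S"
    and grad: "\<And>u. u \<in> S \<Longrightarrow> (f has_derivative (\<lambda>w. g u \<bullet> w)) (at u within S)"
  shows "((\<lambda>t. f (v + t *\<^sub>R h)) has_field_derivative g (v + t *\<^sub>R h) \<bullet> h) (at t)"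
proof -
  have inS: "v + t *\<^sub>R h \<in> S" for t
    using assms by (simp add: subspace_add subspace_scale)
  have "((\<lambda>t. v + t *\<^sub>R h) has_derivative (\<lambda>s. s *\<^sub>R h)) (at t within UNIV)"
    by (auto intro!: derivative_eq_intros)
  then have "(f \<circ> (\<lambda>t. v + t *\<^sub>R h) has_derivative
      (\<lambda>w. g (v + t *\<^sub>R h) \<bullet> w) \<circ> (\<lambda>s. s *\<^sub>R h)) (at t within UNIV)"
    by (rule diff_chain_within)
      (rule has_derivative_subset[OF grad[OF inS]], use inS in auto)
  then show ?thesis
    by (simp add: has_field_derivative_def o_def mult.commute[of _ "_ \<bullet> _"])
qed

text \<open>Restricting \<open>f\<close> to the line through \<open>v\<close> and \<open>w\<close>
  reduces this to the tangent inequality for a convex function of one real variable, at the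
  parameters 0 and 1.\<close>

lemma convex_gradient_lower:
  fixes f :: "'a::real_inner \<Rightarrow> real"
  assumes "subspace S" "v \<in> S" "w \<in> S" "convex_on S f"
    and grad: "\<And>u. u \<in> S \<Longrightarrow> (f has_derivative (\<lambda>w. g u \<bullet> w)) (at u within S)"
  shows "f v + g v \<bullet> (w - v) \<le> f w"
proof -
  have h: "w - v \<in> S" using assms by (simp add: subspace_diff)
  have inS: "v + t *\<^sub>R (w - v) \<in> S" for t
    using assms h by (simp add: subspace_add subspace_scale)
  have "convex_on UNIV (\<lambda>t. f (v + t *\<^sub>R (w - v)))"
  proof (rule convex_onI)
    fix t a b :: real assume "0 < t" "t < 1"
    have "v + ((1 - t) *\<^sub>R a + t *\<^sub>R b) *\<^sub>R (w - v)
        = (1 - t) *\<^sub>R (v + a *\<^sub>R (w - v)) + t *\<^sub>R (v + b *\<^sub>R (w - v))"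
      by (simp add: algebra_simps)
    then show "f (v + ((1 - t) *\<^sub>R a + t *\<^sub>R b) *\<^sub>R (w - v))
        \<le> (1 - t) * f (v + a *\<^sub>R (w - v)) + t * f (v + b *\<^sub>R (w - v))"
      using convex_onD[OF \<open>convex_on S f\<close>, of t "v + a *\<^sub>R (w - v)" "v + b *\<^sub>R (w - v)"]
        inS \<open>0 < t\<close> \<open>t < 1\<close> by simp
  qed simp
  from convex_on_imp_above_tangent[OF this, of 0 1 "g v \<bullet> (w - v)"]
    gradient_along_line[OF assms(1,2) h grad, where t=0]
  show ?thesis by simp
qed

text \<open>The descent lemma, obtained without an integral: the gap \<open>\<psi>\<close> along the
  segment has nonpositive derivative on \<open>[0, 1]\<close>, by Cauchy-Schwarz and the Lipschitz
  bound on \<open>g\<close>.\<close>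

lemma smooth_upper:
  fixes f :: "'a::real_inner \<Rightarrow> real"
  assumes "subspace S" "v \<in> S" "w \<in> S" "L-lipschitz_on S g"
    and grad: "\<And>u. u \<in> S \<Longrightarrow> (f has_derivative (\<lambda>w. g u \<bullet> w)) (at u within S)"
  shows "f w \<le> f v + g v \<bullet> (w - v) + L / 2 * (norm (w - v))\<^sup>2"
proof -
  define h where "h = w - v"
  have h: "h \<in> S" using assms by (simp add: subspace_diff h_def)
  define \<psi> where "\<psi> t = f (v + t *\<^sub>R h) - t * (g v \<bullet> h) - L / 2 * t\<^sup>2 * (norm h)\<^sup>2" for t
  have "\<psi> 1 \<le> \<psi> 0"
  proof (rule DERIV_nonpos_imp_nonincreasing[of 0 1 \<psi>])
    fix t :: real assume t: "0 \<le> t" "t \<le> 1"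
    have tS: "v + t *\<^sub>R h \<in> S" using assms h by (simp add: subspace_add subspace_scale)
    have "(\<psi> has_field_derivative g (v + t *\<^sub>R h) \<bullet> h - g v \<bullet> h - L * t * (norm h)\<^sup>2) (at t)"
      unfolding \<psi>_def
      by (auto intro!: derivative_eq_intros gradient_along_line[OF assms(1,2) h grad])
    moreover have "(g (v + t *\<^sub>R h) - g v) \<bullet> h \<le> norm (g (v + t *\<^sub>R h) - g v) * norm h"
      by (rule norm_cauchy_schwarz)
    moreover have "norm (g (v + t *\<^sub>R h) - g v) \<le> L * (t * norm h)"
      using lipschitz_onD[OF assms(4) tS assms(2)] t by (simp add: dist_norm)
    then have "norm (g (v + t *\<^sub>R h) - g v) * norm h \<le> L * t * (norm h)\<^sup>2"
      using mult_right_mono[of _ _ "norm h"] by (fastforce simp: power2_eq_square mult.assoc)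
    ultimately show "\<exists>y. (\<psi> has_field_derivative y) (at t) \<and> y \<le> 0"
      by (intro exI[of _ "g (v + t *\<^sub>R h) \<bullet> h - g v \<bullet> h - L * t * (norm h)\<^sup>2"])
        (simp add: inner_diff_left)
  qed simp
  then show ?thesis by (simp add: \<psi>_def h_def)
qed

section \<open>Nesterov's method with an inexact oracle\<close>

text \<open>
  \<open>t\<close> is the inverse of Nesterov's momentum parameter and \<open>u\<close>, \<open>v\<close> are the consecutive points of
  the auxiliary sequence whose distance to \<open>q\<close> enters the potential.
\<close>

lemma nesterov_step:
  fixes p q y n g u v :: "'a::real_inner"
  assumes "0 < \<alpha>" "1 \<le> t"
    and n: "n = y - \<alpha> *\<^sub>R g"
    and u: "u = p + t *\<^sub>R (y - p)"
    and v: "v = p + t *\<^sub>R (n - p)"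
    and lower_p: "l + g \<bullet> (p - y) \<le> Fp"
    and lower_q: "l + g \<bullet> (q - y) \<le> Fq"
    and upper: "Fn \<le> l + g \<bullet> (n - y) + 1 / (2 * \<alpha>) * (norm (n - y))\<^sup>2 + \<delta>"
  shows "t\<^sup>2 * (Fn - Fq) + 1 / (2 * \<alpha>) * (norm (v - q))\<^sup>2
    \<le> (t\<^sup>2 - t) * (Fp - Fq) + 1 / (2 * \<alpha>) * (norm (u - q))\<^sup>2 + t\<^sup>2 * \<delta>"
proof -
  define c where "c = 1 / (2 * \<alpha>) * (norm (n - y))\<^sup>2"
  \<comment> \<open>The weights \<open>t - 1\<close> at \<open>p\<close>, 1 at \<open>q\<close> and
    \<open>t\<close> at \<open>n\<close> make the linear terms combine into the single product
    \<open>g \<bullet> (v - q)\<close>. A further factor \<open>t\<close> then produces the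
    coefficients of the potential.\<close>
  have "(t - 1) * (l + g \<bullet> (p - y)) \<le> (t - 1) * Fp"
    using lower_p \<open>1 \<le> t\<close> by (intro mult_left_mono) auto
  moreover have "t * Fn \<le> t * (l + g \<bullet> (n - y) + c + \<delta>)"
    using upper \<open>1 \<le> t\<close> unfolding c_def by (intro mult_left_mono) auto
  moreover have "g \<bullet> (v - q) = t * (g \<bullet> (n - y)) - (t - 1) * (g \<bullet> (p - y)) - g \<bullet> (q - y)"
    unfolding v by (simp add: inner_simps algebra_simps)
  ultimately have "t * Fn \<le> (t - 1) * Fp + Fq + g \<bullet> (v - q) + t * (c + \<delta>)"
    using lower_q by (simp add: algebra_simps)
  then have "t * (t * Fn) \<le> t * ((t - 1) * Fp + Fq + g \<bullet> (v - q) + t * (c + \<delta>))"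
    using \<open>1 \<le> t\<close> by (intro mult_left_mono) auto
  then have main: "t\<^sup>2 * (Fn - Fq) \<le> (t\<^sup>2 - t) * (Fp - Fq) + t * (g \<bullet> (v - q)) + t\<^sup>2 * c + t\<^sup>2 * \<delta>"
    by (simp add: algebra_simps power2_eq_square)
  \<comment> \<open>By this identity the three-point formula for
    \<open>(u - v) \<bullet> (v - q)\<close> turns the gradient term into a difference of squared
    distances to \<open>q\<close>, and its part \<open>(norm (u - v))\<^sup>2\<close> cancels the
    quadratic term \<open>t\<^sup>2 * c\<close> exactly.\<close>
  have uv: "u - v = (t * \<alpha>) *\<^sub>R g"
    unfolding u v n by (simp add: algebra_simps)
  have "t * (g \<bullet> (v - q)) = 1 / \<alpha> * ((u - v) \<bullet> (v - q))"
    unfolding uv using \<open>0 < \<alpha>\<close> by simp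
  also have "(u - v) \<bullet> (v - q) = ((norm (u - q))\<^sup>2 - (norm (u - v))\<^sup>2 - (norm (v - q))\<^sup>2) / 2"
    unfolding power2_norm_eq_inner by (simp add: inner_simps algebra_simps inner_commute)
  also have "(norm (u - v))\<^sup>2 = t\<^sup>2 * (norm (n - y))\<^sup>2"
    unfolding uv n by (simp add: power_mult_distrib)
  finally have "t * (g \<bullet> (v - q)) = 1 / (2 * \<alpha>) * (norm (u - q))\<^sup>2
      - t\<^sup>2 * c - 1 / (2 * \<alpha>) * (norm (v - q))\<^sup>2"
    by (simp add: c_def diff_divide_distrib right_diff_distrib)
  with main show ?thesis by linarith
qed

text \<open>Summing the one-step inequality with \<open>t = (k + 2) / 2\<close> telescopes the
  potential; the oracle error \<open>\<delta> k\<close> enters with weight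
  \<open>t\<^sup>2\<close>.\<close>

lemma inexact_nesterov:
  fixes x y g :: "nat \<Rightarrow> 'a::real_inner" and l \<delta> :: "nat \<Rightarrow> real" and F :: "'a \<Rightarrow> real"
  assumes "0 < \<alpha>"
    and init: "y 0 = x 0"
    and x_Suc: "\<And>k. x (Suc k) = y k - \<alpha> *\<^sub>R g k"
    and y_Suc: "\<And>k. y (Suc k) = x (Suc k) + beta k *\<^sub>R (x (Suc k) - x k)"
    and lower_x: "\<And>k. l k + g k \<bullet> (x k - y k) \<le> F (x k)"
    and lower_q: "\<And>k. l k + g k \<bullet> (q - y k) \<le> F q"
    and upper: "\<And>k. F (x (Suc k)) \<le> l k + g k \<bullet> (x (Suc k) - y k)
        + 1 / (2 * \<alpha>) * (norm (x (Suc k) - y k))\<^sup>2 + \<delta> k"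
    and min: "\<And>k. F q \<le> F (x k)"
  shows "real k * (real k + 2) / 4 * (F (x k) - F q)
    \<le> (norm (x 0 - q))\<^sup>2 / (2 * \<alpha>) + (\<Sum>s<k. (real s + 2)\<^sup>2 / 4 * \<delta> s)"
proof -
  define u where "u k = x k + ((real k + 2) / 2) *\<^sub>R (y k - x k)" for k
  \<comment> \<open>The momentum is matched to \<open>t\<close>:
    \<open>(k + 3) / 2 * beta k = k / 2 = t - 1\<close>, so the point \<open>v\<close> of step
    \<open>k\<close> is the point \<open>u\<close> of step \<open>k + 1\<close>.\<close>
  have u_Suc: "u (Suc k) = x k + ((real k + 2) / 2) *\<^sub>R (x (Suc k) - x k)" for k
  proof -
    have "u (Suc k) = x (Suc k) + ((real k + 3) / 2 * (real k / (real k + 3))) *\<^sub>R (x (Suc k) - x k)"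
      unfolding u_def y_Suc beta_def by (simp add: add.commute)
    also have "(real k + 3) / 2 * (real k / (real k + 3)) = (real k + 2) / 2 - 1"
      by (simp add: field_simps)
    finally show ?thesis by (simp add: algebra_simps)
  qed
  have "real k * (real k + 2) / 4 * (F (x k) - F q) + 1 / (2 * \<alpha>) * (norm (u k - q))\<^sup>2
    \<le> (norm (x 0 - q))\<^sup>2 / (2 * \<alpha>) + (\<Sum>s<k. (real s + 2)\<^sup>2 / 4 * \<delta> s)"
  proof (induction k)
    case 0
    then show ?case by (simp add: u_def init)
  next
    case (Suc k)
    have "((real k + 2) / 2)\<^sup>2 * (F (x (Suc k)) - F q) + 1 / (2 * \<alpha>) * (norm (u (Suc k) - q))\<^sup>2
      \<le> (((real k + 2) / 2)\<^sup>2 - (real k + 2) / 2) * (F (x k) - F q)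
        + 1 / (2 * \<alpha>) * (norm (u k - q))\<^sup>2 + ((real k + 2) / 2)\<^sup>2 * \<delta> k"
      by (rule nesterov_step[OF \<open>0 < \<alpha>\<close> _ x_Suc u_def u_Suc lower_x lower_q upper]) simp
    moreover have "((real k + 2) / 2)\<^sup>2 - (real k + 2) / 2 = real k * (real k + 2) / 4"
      by (simp add: power2_eq_square algebra_simps)
    \<comment> \<open>The gap is nonnegative by \<open>min\<close>, and
      \<open>(k + 1) * (k + 3) \<le> (k + 2)\<^sup>2\<close>, so the weight can be lowered to that
      of the next potential.\<close>
    moreover have "real (Suc k) * (real (Suc k) + 2) / 4 * (F (x (Suc k)) - F q)
        \<le> ((real k + 2) / 2)\<^sup>2 * (F (x (Suc k)) - F q)"
      using min by (intro mult_right_mono) (auto simp: power2_eq_square field_simps)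
    moreover have "((real k + 2) / 2)\<^sup>2 * \<delta> k = (real k + 2)\<^sup>2 / 4 * \<delta> k"
      by (simp add: power_divide)
    ultimately show ?case using Suc.IH by simp
  qed
  moreover have "0 \<le> 1 / (2 * \<alpha>) * (norm (u k - q))\<^sup>2" using \<open>0 < \<alpha>\<close> by simp
  ultimately show ?thesis by linarith
qed

section \<open>Consensus\<close>

text \<open>This is the Euclidean norm of the stacked vector \<open>z\<close> after applying
  \<open>(I - J) \<otimes> I\<close>, that is, of its component orthogonal to consensus.\<close>

definition disagreement :: "nat \<Rightarrow> (nat \<Rightarrow> rvec) \<Rightarrow> real"
  where "disagreement N z = L2_set (\<lambda>i. norm (z i - node_average N z)) {..<N}"

lemma node_average_cong: "(\<And>i. i < N \<Longrightarrow> z i = w i) \<Longrightarrow> node_average N z = node_average N w"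
  by (simp add: node_average_def)

lemma disagreement_cong: "(\<And>i. i < N \<Longrightarrow> z i = w i) \<Longrightarrow> disagreement N z = disagreement N w"
  unfolding disagreement_def using node_average_cong[of N z w] by (intro L2_set_cong) auto

lemma node_average_add:
  "node_average N (\<lambda>i. z i + w i) = node_average N z + node_average N w"
  by (simp add: node_average_def sum.distrib scaleR_add_right)

lemma node_average_scaleR: "node_average N (\<lambda>i. c *\<^sub>R z i) = c *\<^sub>R node_average N z"
  by (simp add: node_average_def scaleR_sum_right)

lemma node_average_diff:
  "node_average N (\<lambda>i. z i - w i) = node_average N z - node_average N w"
  by (simp add: node_average_def sum_subtractf scaleR_diff_right)

lemma sum_minus_node_average: "0 < N \<Longrightarrow> (\<Sum>i<N. z i - node_average N z) = 0"
  by (simp add: node_average_def sum_subtractf sum_constant_scaleR del: sum_constant)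

text \<open>A bias-variance decomposition: the cross term vanishes because deviations from the
  average sum to zero.\<close>

lemma sum_norm_minus_node_average:
  assumes "0 < N"
  shows "(\<Sum>i<N. (norm (q - z i))\<^sup>2)
    = real N * (norm (q - node_average N z))\<^sup>2 + (disagreement N z)\<^sup>2"
proof -
  define a where "a = node_average N z"
  have "(norm (q - z i))\<^sup>2
      = (norm (q - a))\<^sup>2 - 2 * ((q - a) \<bullet> (z i - a)) + (norm (z i - a))\<^sup>2" for i
    unfolding power2_norm_eq_inner by (simp add: inner_simps algebra_simps inner_commute)
  then have "(\<Sum>i<N. (norm (q - z i))\<^sup>2) = real N * (norm (q - a))\<^sup>2
      - 2 * ((q - a) \<bullet> (\<Sum>i<N. z i - a)) + (\<Sum>i<N. (norm (z i - a))\<^sup>2)"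
    by (simp add: sum.distrib sum_distrib_left inner_sum_right) (simp add: sum_subtractf)
  then show ?thesis
    using sum_minus_node_average[OF assms, of z]
    by (simp add: a_def disagreement_def L2_set_def sum_nonneg)
qed

text \<open>Subtracting the average is an orthogonal projection; the bound is the decomposition
  above at \<open>q = 0\<close>.\<close>

lemma disagreement_le_norm:
  assumes "0 < N"
  shows "disagreement N z \<le> L2_set (\<lambda>i. norm (z i)) {..<N}"
proof (rule power2_le_imp_le)
  show "(disagreement N z)\<^sup>2 \<le> (L2_set (\<lambda>i. norm (z i)) {..<N})\<^sup>2"
    using sum_norm_minus_node_average[OF assms, of 0 z]
    by (simp add: L2_set_def sum_nonneg)
qed simp

lemma disagreement_nonneg: "0 \<le> disagreement N z"
  by (simp add: disagreement_def)

lemma norm_minus_node_average_le: "i < N \<Longrightarrow> norm (z i - node_average N z) \<le> disagreement N z"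
  unfolding disagreement_def by (rule member_le_L2_set) auto

lemma disagreement_add:
  "disagreement N (\<lambda>i. z i + w i) \<le> disagreement N z + disagreement N w"
proof -
  have "disagreement N (\<lambda>i. z i + w i) \<le>
      L2_set (\<lambda>i. norm (z i - node_average N z) + norm (w i - node_average N w)) {..<N}"
    unfolding disagreement_def node_average_add
    by (intro L2_set_mono) (auto simp: add_diff_add norm_triangle_ineq)
  also have "\<dots> \<le> disagreement N z + disagreement N w"
    unfolding disagreement_def by (rule L2_set_triangle_ineq)
  finally show ?thesis .
qed

lemma disagreement_scaleR: "disagreement N (\<lambda>i. c *\<^sub>R z i) = \<bar>c\<bar> * disagreement N z"
  unfolding disagreement_def node_average_scaleR scaleR_diff_right[symmetric] norm_scaleR
  by (rule L2_set_right_distrib[symmetric]) simp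

lemma disagreement_diff:
  "disagreement N (\<lambda>i. z i - w i) \<le> disagreement N z + disagreement N w"
  using disagreement_add[of N z "\<lambda>i. (-1) *\<^sub>R w i"] disagreement_scaleR[of N "-1" w] by simp

section \<open>Contraction of disagreements by mixing\<close>

lemma spectral_norm_bound:
  "L2_set (\<lambda>i. \<Sum>j<N. A i j * v j) {..<N} \<le> spectral_norm N A * L2_set v {..<N}"
proof (cases "L2_set v {..<N} = 0")
  case True
  then have "\<forall>j<N. v j = 0" by (simp add: L2_set_eq_0_iff)
  then have "L2_set (\<lambda>i. \<Sum>j<N. A i j * v j) {..<N} = 0"
    by (subst L2_set_eq_0_iff) auto
  then show ?thesis using True by simp
next
  case False
  let ?S = "{v. L2_set v {..<N} = 1}"
  let ?h = "\<lambda>v. L2_set (\<lambda>i. \<Sum>j<N. A i j * v j) {..<N}"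
  define c where "c = L2_set v {..<N}"
  have c: "0 < c" using False L2_set_nonneg[of v "{..<N}"] unfolding c_def by linarith
  \<comment> \<open>The supremum in \<open>spectral_norm\<close> is an upper bound only if the set
    is bounded above. Entries of a unit vector are at most 1 in absolute value, so absolute row sums
    give a bound.\<close>
  have bdd: "bdd_above (?h ` ?S)"
  proof (rule bdd_aboveI2)
    fix w assume w: "w \<in> ?S"
    have "\<bar>\<Sum>j<N. A i j * w j\<bar> \<le> (\<Sum>j<N. \<bar>A i j\<bar>)" for i
    proof -
      have "\<bar>w j\<bar> \<le> 1" if "j < N" for j
      proof -
        have "\<bar>w j\<bar> \<le> L2_set (\<lambda>j. \<bar>w j\<bar>) {..<N}"
          by (rule member_le_L2_set) (use that in auto)
        also have "\<dots> = 1" using w by (simp add: L2_set_def)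
        finally show ?thesis .
      qed
      then have "(\<Sum>j<N. \<bar>A i j * w j\<bar>) \<le> (\<Sum>j<N. \<bar>A i j\<bar>)"
        by (intro sum_mono) (auto simp: abs_mult mult_left_le)
      then show ?thesis by (rule order_trans[OF sum_abs])
    qed
    then have "L2_set (\<lambda>i. \<bar>\<Sum>j<N. A i j * w j\<bar>) {..<N} \<le> L2_set (\<lambda>i. \<Sum>j<N. \<bar>A i j\<bar>) {..<N}"
      by (intro L2_set_mono) auto
    then show "?h w \<le> L2_set (\<lambda>i. \<Sum>j<N. \<bar>A i j\<bar>) {..<N}"
      by (simp add: L2_set_def)
  qed
  have "L2_set (\<lambda>j. (1 / c) * v j) {..<N} = 1"
    using L2_set_right_distrib[of "1 / c" v "{..<N}"] c by (simp add: c_def)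
  then have "?h (\<lambda>j. (1 / c) * v j) \<le> spectral_norm N A"
    unfolding spectral_norm_def by (intro cSUP_upper[OF _ bdd]) simp
  also have "?h (\<lambda>j. (1 / c) * v j) = L2_set (\<lambda>i. (1 / c) * (\<Sum>j<N. A i j * v j)) {..<N}"
    by (simp add: sum_distrib_left mult.left_commute)
  also have "\<dots> = (1 / c) * ?h v"
    using L2_set_right_distrib[of "1 / c" _ "{..<N}"] c by simp
  finally show ?thesis using c by (simp add: c_def[symmetric] field_simps)
qed

text \<open>On vectors with zero sum \<open>J\<close> vanishes, so \<open>W\<close> acts as
  \<open>W - J\<close> in every coordinate. The scalar bounds are squared and summed over
  coordinates.\<close>

lemma mu_contraction:
  fixes z :: "nat \<Rightarrow> rvec"
  assumes "(\<Sum>j<N. z j) = 0" "0 \<le> mu N W"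
  shows "L2_set (\<lambda>i. norm (mix N W z i)) {..<N} \<le> mu N W * L2_set (\<lambda>i. norm (z i)) {..<N}"
proof -
  \<comment> \<open>A finite set containing all supports: every norm becomes a sum over the same
    coordinates, and the sums over nodes and coordinates can be exchanged.\<close>
  let ?K = "(\<Union>j<N. Poly_Mapping.keys (z j))"
  have lookup_mix: "Poly_Mapping.lookup (mix N W z i) l
      = (\<Sum>j<N. W i j * Poly_Mapping.lookup (z j) l)" for i l
    by (simp add: mix_def lookup_sum lookup_scaleR)
  have keys_mix: "Poly_Mapping.keys (mix N W z i) \<subseteq> ?K" for i
  proof
    fix l assume "l \<in> Poly_Mapping.keys (mix N W z i)"
    then have "(\<Sum>j<N. W i j * Poly_Mapping.lookup (z j) l) \<noteq> 0"
      by (simp add: in_keys_iff lookup_mix)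
    then obtain j where "j < N" "W i j * Poly_Mapping.lookup (z j) l \<noteq> 0"
      by (auto elim: sum.not_neutral_contains_not_neutral)
    then show "l \<in> ?K" by (auto simp: in_keys_iff)
  qed
  have norm_K: "(norm p)\<^sup>2 = (\<Sum>l\<in>?K. (Poly_Mapping.lookup p l)\<^sup>2)"
    if "Poly_Mapping.keys p \<subseteq> ?K" for p :: rvec
    unfolding power2_norm_eq_inner using that
    by (subst inner_poly_mapping_superset[of ?K]) (auto simp: power2_eq_square)
  have coord: "(\<Sum>i<N. (Poly_Mapping.lookup (mix N W z i) l)\<^sup>2)
      \<le> (mu N W)\<^sup>2 * (\<Sum>i<N. (Poly_Mapping.lookup (z i) l)\<^sup>2)" for l
  proof -
    have zero: "(\<Sum>j<N. Poly_Mapping.lookup (z j) l) = 0"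
      using assms(1) by (metis lookup_sum lookup_zero)
    have "(\<Sum>j<N. (W i j - 1 / real N) * Poly_Mapping.lookup (z j) l)
        = Poly_Mapping.lookup (mix N W z i) l" for i
      by (simp add: left_diff_distrib sum_subtractf lookup_mix zero flip: sum_divide_distrib)
    then have "L2_set (\<lambda>i. Poly_Mapping.lookup (mix N W z i) l) {..<N}
        \<le> mu N W * L2_set (\<lambda>j. Poly_Mapping.lookup (z j) l) {..<N}"
      using spectral_norm_bound[where N=N and A="\<lambda>i j. W i j - 1 / real N"
          and v="\<lambda>j. Poly_Mapping.lookup (z j) l"]
      by (simp add: mu_def)
    then have "(L2_set (\<lambda>i. Poly_Mapping.lookup (mix N W z i) l) {..<N})\<^sup>2
        \<le> (mu N W * L2_set (\<lambda>j. Poly_Mapping.lookup (z j) l) {..<N})\<^sup>2"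
      by (rule power_mono) simp
    then show ?thesis by (simp add: L2_set_def sum_nonneg power_mult_distrib)
  qed
  have "(\<Sum>i<N. (norm (mix N W z i))\<^sup>2)
      = (\<Sum>l\<in>?K. \<Sum>i<N. (Poly_Mapping.lookup (mix N W z i) l)\<^sup>2)"
    by (subst sum.swap) (simp add: norm_K[OF keys_mix])
  also have "\<dots> \<le> (\<Sum>l\<in>?K. (mu N W)\<^sup>2 * (\<Sum>i<N. (Poly_Mapping.lookup (z i) l)\<^sup>2))"
    by (intro sum_mono coord)
  also have "\<dots> = (mu N W)\<^sup>2 * (\<Sum>i<N. \<Sum>l\<in>?K. (Poly_Mapping.lookup (z i) l)\<^sup>2)"
    unfolding sum_distrib_left[symmetric] by (subst sum.swap) (rule refl)
  also have "(\<Sum>i<N. \<Sum>l\<in>?K. (Poly_Mapping.lookup (z i) l)\<^sup>2) = (\<Sum>i<N. (norm (z i))\<^sup>2)"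
    by (intro sum.cong refl norm_K[symmetric]) auto
  finally have "(L2_set (\<lambda>i. norm (mix N W z i)) {..<N})\<^sup>2
      \<le> (mu N W * L2_set (\<lambda>i. norm (z i)) {..<N})\<^sup>2"
    by (simp add: L2_set_def sum_nonneg power_mult_distrib)
  then show ?thesis
    by (rule power2_le_imp_le) (simp add: assms)
qed

text \<open>Column sums equal to one make mixing preserve the total.\<close>

lemma node_average_mix:
  assumes "doubly_stochastic N W"
  shows "node_average N (mix N W z) = node_average N z"
proof -
  have "(\<Sum>i<N. \<Sum>j<N. W i j *\<^sub>R z j) = (\<Sum>j<N. (\<Sum>i<N. W i j) *\<^sub>R z j)"
    by (subst sum.swap) (simp add: scaleR_sum_left)
  also have "\<dots> = (\<Sum>j<N. z j)"
    using assms by (simp add: doubly_stochastic_def)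
  finally show ?thesis by (simp add: node_average_def mix_def)
qed

text \<open>Row sums equal to one let the average be subtracted before mixing instead of after; the
  deviations have zero sum, so the contraction applies to them.\<close>

lemma disagreement_mix:
  assumes "0 < N" "doubly_stochastic N W" "0 \<le> mu N W"
  shows "disagreement N (mix N W z) \<le> mu N W * disagreement N z"
proof -
  have "mix N W z i - node_average N z = mix N W (\<lambda>j. z j - node_average N z) i" if "i < N" for i
  proof -
    have "(\<Sum>j<N. W i j) = 1" using assms that by (simp add: doubly_stochastic_def)
    then show ?thesis
      by (simp add: mix_def scaleR_diff_right sum_subtractf flip: scaleR_sum_left)
  qed
  then have "disagreement N (mix N W z)
      = L2_set (\<lambda>i. norm (mix N W (\<lambda>j. z j - node_average N z) i)) {..<N}"
    unfolding disagreement_def node_average_mix[OF assms(2)] by (intro L2_set_cong) auto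
  also have "\<dots> \<le> mu N W * disagreement N z"
    unfolding disagreement_def
    by (rule mu_contraction) (use assms sum_minus_node_average in auto)
  finally show ?thesis .
qed

lemma node_average_mix_pow:
  "doubly_stochastic N W \<Longrightarrow> node_average N ((mix N W ^^ n) z) = node_average N z"
  by (induction n) (simp_all add: node_average_mix)

lemma disagreement_mix_pow:
  assumes "0 < N" "doubly_stochastic N W" "0 \<le> mu N W"
  shows "disagreement N ((mix N W ^^ n) z) \<le> mu N W ^ n * disagreement N z"
proof (induction n)
  case (Suc n)
  have "disagreement N (mix N W ((mix N W ^^ n) z)) \<le> mu N W * disagreement N ((mix N W ^^ n) z)"
    by (rule disagreement_mix[OF assms])
  also have "\<dots> \<le> mu N W * (mu N W ^ n * disagreement N z)"
    using Suc assms by (intro mult_left_mono) auto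
  finally show ?case by (simp add: mult.assoc)
qed simp

lemma mix_pow_in_subspace:
  assumes "subspace S" "\<And>i. i < N \<Longrightarrow> z i \<in> S" "i < N"
  shows "(mix N W ^^ n) z i \<in> S"
  using assms(3)
proof (induction n arbitrary: i)
  case (Suc n)
  then show ?case
    using assms(1) by (auto simp: mix_def[of N W "(mix N W ^^ n) z"] intro!: subspace_sum subspace_scale)
qed (use assms in auto)

section \<open>Communication rounds\<close>

text \<open>Used for \<open>n\<close> the ceiling of \<open>a / (- ln m)\<close>, with
  \<open>a = 2 * ln k\<close> for \<open>tau_x\<close> and \<open>a = ln 3 + 2 * ln k\<close> for
  \<open>tau_y\<close>.\<close>

lemma power_le_exp_minus:
  fixes m :: real
  assumes "0 < m" "m < 1" "a / (- ln m) \<le> real n"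
  shows "m ^ n \<le> exp (- a)"
proof -
  have "- ln m > 0" using assms by simp
  then have "a \<le> real n * (- ln m)" using assms(3) by (simp only: divide_le_eq if_True)
  then have "real n * ln m \<le> - a" by simp
  moreover have "m ^ n = exp (real n * ln m)"
    using assms by (simp add: exp_of_nat_mult)
  ultimately show ?thesis by simp
qed

lemma mu_pow_tau_x:
  assumes "0 < m" "m < 1" "1 \<le> k"
  shows "m ^ tau_x m k \<le> 1 / (real k)\<^sup>2"
proof -
  have "m ^ tau_x m k \<le> exp (- (2 * ln (real k)))"
    unfolding tau_x_def by (rule power_le_exp_minus) (use assms in linarith)+
  also have "\<dots> = 1 / (real k)\<^sup>2"
    using assms by (simp add: exp_minus exp_double inverse_eq_divide)
  finally show ?thesis .
qed

lemma mu_pow_tau_y: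
  assumes "0 < m" "m < 1" "1 \<le> k"
  shows "m ^ tau_y m k \<le> 1 / (3 * (real k)\<^sup>2)"
proof -
  have "m ^ tau_y m k \<le> exp (- (ln 3 + 2 * ln (real k)))"
    unfolding tau_y_def add_divide_distrib[symmetric]
    by (rule power_le_exp_minus) (use assms in linarith)+
  also have "\<dots> = 1 / (3 * (real k)\<^sup>2)"
    using assms by (simp add: exp_minus exp_add exp_double inverse_eq_divide exp_diff)
  finally show ?thesis .
qed

text \<open>The summand \<open>ln 3\<close> forces \<open>tau_y m 1\<close> to be positive, although
  \<open>tau_x m 1\<close> is zero. This keeps the argument of \<open>rate_bound\<close> away from
  division by zero.\<close>

lemma comm_rounds_pos:
  assumes "0 < m" "m < 1" "1 \<le> k"
  shows "0 < comm_rounds m k"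
proof -
  have "0 < ln 3 / (- ln m)" using assms by (intro divide_pos_pos) auto
  then have "0 < tau_y m 1" by (simp add: tau_y_def)
  also have "tau_y m 1 \<le> comm_rounds m k"
    unfolding comm_rounds_def using assms
    by (intro order_trans[OF _ member_le_sum[of 1]]) auto
  finally show ?thesis .
qed

text \<open>From \<open>1 - m \<le> - ln m\<close>, the factor \<open>1 - m\<close> turns each
  quotient \<open>a / (- ln m)\<close> into at most \<open>a\<close>, and rounding up costs at most
  1.\<close>

lemma comm_rounds_le:
  assumes "0 < m" "m < 1" "1 \<le> k"
  shows "(1 - m) * real (comm_rounds m k) \<le> 4 * real k * (1 + ln (real k))"
proof -
  have ln_m: "1 - m \<le> - ln m" "0 < - ln m"
    using ln_le_minus_one[of m] assms by auto
  have ceil: "(1 - m) * real (nat \<lceil>a / (- ln m)\<rceil>) \<le> a + 1" if "0 \<le> a" for a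
  proof -
    have "0 \<le> a / (- ln m)" using that ln_m(2) by (intro divide_nonneg_pos)
    then have "real (nat \<lceil>a / (- ln m)\<rceil>) \<le> a / (- ln m) + 1" by linarith
    then have "(1 - m) * real (nat \<lceil>a / (- ln m)\<rceil>) \<le> (1 - m) * (a / (- ln m)) + (1 - m)"
      using assms mult_left_mono[of "real (nat \<lceil>a / (- ln m)\<rceil>)" "a / (- ln m) + 1" "1 - m"]
      by (simp only: distrib_left) simp
    also have "(1 - m) * (a / (- ln m)) \<le> (- ln m) * (a / (- ln m))"
      using \<open>0 \<le> a / (- ln m)\<close> ln_m by (intro mult_right_mono) auto
    also have "(- ln m) * (a / (- ln m)) = a" using ln_m by simp
    finally show ?thesis using assms by simp
  qed
  have "ln (3::real) \<le> 2" using ln_le_minus_one[of "3::real"] by simp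
  have "(1 - m) * real (tau_x m t + tau_y m t) \<le> 4 * (1 + ln (real k))" if t: "1 \<le> t" "t \<le> k" for t
  proof -
    have "0 \<le> ln (real t)" "ln (real t) \<le> ln (real k)" using t by auto
    moreover have "(1 - m) * real (tau_x m t) \<le> 2 * ln (real t) + 1"
      unfolding tau_x_def using t by (intro ceil) simp
    moreover have "(1 - m) * real (tau_y m t) \<le> ln 3 + 2 * ln (real t) + 1"
      unfolding tau_y_def add_divide_distrib[symmetric] using t by (intro ceil) simp
    ultimately show ?thesis
      using \<open>ln (3::real) \<le> 2\<close> by (simp add: distrib_left)
  qed
  then have "(\<Sum>t = 1..k. (1 - m) * real (tau_x m t + tau_y m t)) \<le> (\<Sum>t = 1..k. 4 * (1 + ln (real k)))"
    by (intro sum_mono) auto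
  also have "\<dots> = 4 * real k * (1 + ln (real k))" by simp
  finally show ?thesis by (simp add: comm_rounds_def sum_distrib_left)
qed

text \<open>The exponent \<open>1 - \<xi>\<close> absorbs the logarithm: \<open>ln k\<close> is at
  most \<open>k powr e / e\<close>, and \<open>e\<close> is chosen so that
  \<open>(1 + e) * (1 - \<xi>) = 1\<close>, which makes the power of \<open>k\<close> exactly
  linear.\<close>

lemma scaled_comm_rounds_le:
  assumes "0 < m" "m < 1" "1 \<le> k" "0 < \<xi>" "\<xi> < 1"
  shows "(1 - m) * real (comm_rounds m k) powr (1 - \<xi>) \<le> 4 / \<xi> * real k"
proof -
  define e where "e = \<xi> / (1 - \<xi>)"
  have e: "0 < e" "1 + 1 / e = 1 / \<xi>" "(1 + e) * (1 - \<xi>) = 1"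
    using assms by (auto simp: e_def field_simps)
  have K: "0 < real (comm_rounds m k)" using comm_rounds_pos assms by simp
  have "1 \<le> real k powr e" using assms e by (simp add: ge_one_powr_ge_zero)
  have "e * ln (real k) \<le> real k powr e"
    using ln_le_minus_one[of "real k powr e"] assms by (simp add: ln_powr)
  then have "ln (real k) \<le> 1 / e * real k powr e"
    using e by (simp add: field_simps)
  then have "1 + ln (real k) \<le> (1 + 1 / e) * real k powr e"
    using \<open>1 \<le> real k powr e\<close> by (simp add: distrib_right)
  then have "4 * real k * (1 + ln (real k)) \<le> 4 * real k * ((1 + 1 / e) * real k powr e)"
    by (intro mult_left_mono) auto
  also have "\<dots> = 4 / \<xi> * real k powr (1 + e)"
    unfolding e(2) using assms by (simp add: powr_add)
  finally have bound: "(1 - m) * real (comm_rounds m k) \<le> 4 / \<xi> * real k powr (1 + e)"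
    using comm_rounds_le[of m k] assms by linarith
  \<comment> \<open>As \<open>1 - m \<le> 1\<close>, its power with exponent
    \<open>1 - \<xi>\<close> is at least as large, so the exponent may be applied to the whole
    product \<open>(1 - m) * \<K>\<close>, which \<open>bound\<close> controls.\<close>
  have "(1 - m) powr 1 \<le> (1 - m) powr (1 - \<xi>)"
    using assms by (intro powr_mono') auto
  then have "(1 - m) * real (comm_rounds m k) powr (1 - \<xi>)
      \<le> (1 - m) powr (1 - \<xi>) * real (comm_rounds m k) powr (1 - \<xi>)"
    using assms by (intro mult_right_mono) auto
  also have "\<dots> = ((1 - m) * real (comm_rounds m k)) powr (1 - \<xi>)"
    using assms by (simp add: powr_mult)
  also have "\<dots> \<le> (4 / \<xi> * real k powr (1 + e)) powr (1 - \<xi>)"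
    using bound assms by (intro powr_mono2) auto
  also have "\<dots> = (4 / \<xi>) powr (1 - \<xi>) * real k"
    unfolding powr_mult powr_powr e(3) by simp
  also have "(4 / \<xi>) powr (1 - \<xi>) \<le> (4 / \<xi>) powr 1"
    using assms by (intro powr_mono) auto
  finally show ?thesis using assms by (simp add: mult_right_mono)
qed

section \<open>Comparing rates, and a summable series\<close>

lemma rate_bound_mono:
  assumes "0 < s" "s \<le> D * r" "1 \<le> D" "0 < r"
  shows "rate_bound N r \<le> D ^ 4 * rate_bound N s"
proof -
  \<comment> \<open>Since \<open>1 \<le> D\<close>, the factor \<open>D ^ 4\<close> serves all three
    exponents 2, 3 and 4 of \<open>rate_bound\<close>.\<close>
  have "1 / r ^ n \<le> D ^ 4 * (1 / s ^ n)" if "n \<le> 4" for n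
  proof -
    have "s ^ n \<le> (D * r) ^ n" using assms by (intro power_mono) auto
    also have "\<dots> \<le> D ^ 4 * r ^ n"
      using assms that by (auto simp: power_mult_distrib intro!: mult_right_mono power_increasing)
    finally show ?thesis using assms by (simp add: field_simps)
  qed
  from this[of 2] mult_left_mono[OF this[of 3], of "sqrt (real N)"]
    mult_left_mono[OF this[of 4], of "real N"]
  show ?thesis by (simp add: rate_bound_def distrib_left mult.commute[of _ "D ^ 4"])
qed

text \<open>The term for \<open>s = 0\<close> is \<open>1 / 0 = 0\<close>.\<close>

lemma sum_inverse_squares_le: "(\<Sum>s<k. 1 / (real s)\<^sup>2) \<le> 2"
proof -
  \<comment> \<open>The extra term \<open>1 / (k + 1)\<close> makes the induction telescope. The
    shift by two starts it at the terms \<open>s = 0\<close> and \<open>s = 1\<close>, where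
    equality holds.\<close>
  have "(\<Sum>s<k + 2. 1 / (real s)\<^sup>2) \<le> 2 - 1 / (real k + 1)"
  proof (induction k)
    case 0
    then show ?case by (simp add: numeral_2_eq_2)
  next
    case (Suc k)
    have "1 / (real k + 2)\<^sup>2 \<le> 1 / ((real k + 1) * (real k + 2))"
      by (intro divide_left_mono) (auto simp: power2_eq_square)
    also have "\<dots> = 1 / (real k + 1) - 1 / (real k + 2)"
      by (simp add: field_simps)
    finally show ?case using Suc by (simp add: add.commute)
  qed
  moreover have "(\<Sum>s<k. 1 / (real s)\<^sup>2) \<le> (\<Sum>s<k + 2. 1 / (real s)\<^sup>2)"
    by (intro sum_mono2) auto
  moreover have "0 \<le> 1 / (real k + 1)" by simp
  ultimately show ?thesis by linarith
qed

section \<open>Runs of the algorithm\<close>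

text \<open>One fixed run on one network, so that the final bounds can be stated with explicit
  constants. The form \<open>L * \<alpha> \<le> 1 / 2\<close> of the step-size condition also covers
  \<open>L = 0\<close>.\<close>

locale dnc =
  fixes N d :: nat and W :: "nat \<Rightarrow> nat \<Rightarrow> real" and f :: "nat \<Rightarrow> rvec \<Rightarrow> real"
    and grad :: "nat \<Rightarrow> rvec \<Rightarrow> rvec" and xstar :: rvec and x y :: "nat \<Rightarrow> nat \<Rightarrow> rvec"
    and L G R \<alpha> :: real
  assumes N_pos: "0 < N"
    and stochastic: "doubly_stochastic N W"
    and mu_pos: "0 < mu N W" and mu_less_1: "mu N W < 1"
    and convex: "\<And>i. i < N \<Longrightarrow> convex_on (Rn d) (f i)"
    and gradient: "\<And>i. i < N \<Longrightarrow> is_gradient_on d (f i) (grad i)"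
    and lipschitz: "\<And>i. i < N \<Longrightarrow> L-lipschitz_on (Rn d) (grad i)"
    and bounded: "\<And>i z. i < N \<Longrightarrow> z \<in> Rn d \<Longrightarrow> norm (grad i z) \<le> G"
    and xstar: "xstar \<in> Rn d"
    and minimal: "\<And>z. z \<in> Rn d \<Longrightarrow> total_cost N f xstar \<le> total_cost N f z"
    and run: "dnc_run N W d grad \<alpha> x y"
    and start: "norm (node_average N (x 0) - xstar) \<le> R"
    and step_pos: "0 < \<alpha>" and step_le: "L * \<alpha> \<le> 1 / 2"
begin

section \<open>Quantities attached to a run\<close>

definition mean_cost :: "rvec \<Rightarrow> real"
  where "mean_cost z = total_cost N f z / real N"

definition xbar :: "nat \<Rightarrow> rvec" where "xbar k = node_average N (x k)"
definition ybar :: "nat \<Rightarrow> rvec" where "ybar k = node_average N (y k)"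
definition gbar :: "nat \<Rightarrow> rvec" where "gbar k = node_average N (\<lambda>i. grad i (y k i))"

text \<open>The average of the local tangent values at \<open>ybar k\<close>. Together,
  \<open>model k\<close> and \<open>gbar k\<close> form the inexact first-order oracle for
  \<open>mean_cost\<close>.\<close>

definition model :: "nat \<Rightarrow> real"
  where "model k = (\<Sum>i<N. f i (y k i) + grad i (y k i) \<bullet> (ybar k - y k i)) / real N"

text \<open>A bound for the Euclidean norm of the stacked gradient step: \<open>N\<close> blocks,
  each of norm at most \<open>\<alpha> * G\<close>.\<close>

definition B :: real where "B = \<alpha> * sqrt (real N) * G"

lemma L_nonneg: "0 \<le> L"
  using lipschitz[OF N_pos] by (rule lipschitz_on_nonneg)

lemma G_nonneg: "0 \<le> G"
  using bounded[OF N_pos xstar] norm_ge_zero order_trans by blast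

lemma B_nonneg: "0 \<le> B"
  using step_pos G_nonneg by (simp add: B_def)

lemma has_gradient:
  "i < N \<Longrightarrow> z \<in> Rn d \<Longrightarrow> (f i has_derivative (\<lambda>w. grad i z \<bullet> w)) (at z within Rn d)"
  using gradient by (simp add: is_gradient_on_def)

lemma grad_in_Rn: "i < N \<Longrightarrow> z \<in> Rn d \<Longrightarrow> grad i z \<in> Rn d"
  using gradient by (simp add: is_gradient_on_def)

lemma start_eq: "\<exists>x0\<in>Rn d. \<forall>i<N. x 0 i = x0 \<and> y 0 i = x0"
  using run by (simp add: dnc_run_def)

lemma x_Suc: "i < N \<Longrightarrow> x (Suc k) i =
    (mix N W ^^ tau_x (mu N W) (Suc k)) (\<lambda>j. y k j - \<alpha> *\<^sub>R grad j (y k j)) i"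
  using run by (simp add: dnc_run_def)

lemma y_Suc: "i < N \<Longrightarrow> y (Suc k) i =
    (mix N W ^^ tau_y (mu N W) (Suc k)) (\<lambda>j. x (Suc k) j + beta k *\<^sub>R (x (Suc k) j - x k j)) i"
  using run by (simp add: dnc_run_def)

text \<open>Convexity and smoothness of the \<open>f i\<close> are available only on
  \<open>Rn d\<close>, so the iterates must stay there.\<close>

lemma iterates_in_Rn: "i < N \<Longrightarrow> x k i \<in> Rn d \<and> y k i \<in> Rn d"
proof (induction k arbitrary: i)
  case 0
  then show ?case using start_eq by auto
next
  case (Suc k)
  have x: "x (Suc k) i \<in> Rn d" if "i < N" for i
    unfolding x_Suc[OF that]
    by (rule mix_pow_in_subspace[OF subspace_Rn])
      (use Suc.IH that in \<open>auto intro!: subspace_diff subspace_scale subspace_Rn grad_in_Rn\<close>)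
  have "y (Suc k) i \<in> Rn d"
    unfolding y_Suc[OF Suc.prems]
    by (rule mix_pow_in_subspace[OF subspace_Rn])
      (use Suc x in \<open>auto intro!: subspace_add subspace_diff subspace_scale subspace_Rn\<close>)
  then show ?case using x Suc.prems by blast
qed

lemmas x_in_Rn = conjunct1[OF iterates_in_Rn]
  and y_in_Rn = conjunct2[OF iterates_in_Rn]

section \<open>Dynamics of the averages\<close>

lemma node_average_in_Rn: "(\<And>i. i < N \<Longrightarrow> z i \<in> Rn d) \<Longrightarrow> node_average N z \<in> Rn d"
  unfolding node_average_def by (intro subspace_scale subspace_sum subspace_Rn) auto

lemma xbar_in_Rn: "xbar k \<in> Rn d"
  unfolding xbar_def using x_in_Rn by (rule node_average_in_Rn)

text \<open>Mixing preserves averages, so the communication rounds disappear and a gradient step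
  with \<open>gbar\<close> remains.\<close>

lemma xbar_Suc: "xbar (Suc k) = ybar k - \<alpha> *\<^sub>R gbar k"
proof -
  have "xbar (Suc k) = node_average N
      ((mix N W ^^ tau_x (mu N W) (Suc k)) (\<lambda>j. y k j - \<alpha> *\<^sub>R grad j (y k j)))"
    unfolding xbar_def by (rule node_average_cong) (rule x_Suc)
  then show ?thesis
    by (simp only: node_average_mix_pow[OF stochastic] node_average_diff node_average_scaleR
        ybar_def gbar_def)
qed

lemma ybar_Suc: "ybar (Suc k) = xbar (Suc k) + beta k *\<^sub>R (xbar (Suc k) - xbar k)"
proof -
  have "ybar (Suc k) = node_average N ((mix N W ^^ tau_y (mu N W) (Suc k))
      (\<lambda>j. x (Suc k) j + beta k *\<^sub>R (x (Suc k) j - x k j)))"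
    unfolding ybar_def by (rule node_average_cong) (rule y_Suc)
  then show ?thesis
    by (simp only: node_average_mix_pow[OF stochastic] node_average_add node_average_diff
        node_average_scaleR xbar_def)
qed

lemma ybar_0: "ybar 0 = xbar 0"
  unfolding xbar_def ybar_def using start_eq by (intro node_average_cong) auto

section \<open>Decay of the disagreements\<close>

lemma disagreement_0: "disagreement N (x 0) = 0" "disagreement N (y 0) = 0"
proof -
  obtain x0 where "\<forall>i<N. x 0 i = x0 \<and> y 0 i = x0" using start_eq by blast
  moreover have "disagreement N (\<lambda>i. x0) = 0"
    using sum_minus_node_average[OF N_pos, of "\<lambda>i. x0"] N_pos
    by (simp add: disagreement_def L2_set_eq_0_iff sum_constant_scaleR del: sum_constant)
  ultimately show "disagreement N (x 0) = 0" "disagreement N (y 0) = 0"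
    using disagreement_cong[of N "x 0" "\<lambda>i. x0"] disagreement_cong[of N "y 0" "\<lambda>i. x0"] by auto
qed

lemma disagreement_grad_le: "\<alpha> * disagreement N (\<lambda>i. grad i (y k i)) \<le> B"
proof -
  have "disagreement N (\<lambda>i. grad i (y k i)) \<le> L2_set (\<lambda>i. norm (grad i (y k i))) {..<N}"
    by (rule disagreement_le_norm[OF N_pos])
  also have "\<dots> \<le> L2_set (\<lambda>i. G) {..<N}"
    by (intro L2_set_mono) (auto intro: bounded y_in_Rn)
  also have "\<dots> = sqrt (real N) * G"
    using G_nonneg by (simp add: L2_set_def real_sqrt_mult)
  finally show ?thesis using step_pos by (simp add: B_def mult.assoc)
qed

lemma disagreement_x_Suc:
  "disagreement N (x (Suc k)) \<le> (disagreement N (y k) + B) / (real k + 1)\<^sup>2"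
proof -
  let ?z = "\<lambda>j. y k j - \<alpha> *\<^sub>R grad j (y k j)"
  have "disagreement N (x (Suc k)) \<le> mu N W ^ tau_x (mu N W) (Suc k) * disagreement N ?z"
    using disagreement_cong[of N "x (Suc k)", OF x_Suc]
      disagreement_mix_pow[OF N_pos stochastic less_imp_le[OF mu_pos]] by simp
  also have "\<dots> \<le> 1 / (real (Suc k))\<^sup>2 * disagreement N ?z"
    using mu_pos mu_less_1 by (intro mult_right_mono mu_pow_tau_x disagreement_nonneg) auto
  also have "disagreement N ?z \<le> disagreement N (y k) + B"
    using disagreement_diff[of N "y k" "\<lambda>j. \<alpha> *\<^sub>R grad j (y k j)"] step_pos
      disagreement_grad_le[of k] by (simp add: disagreement_scaleR)
  finally show ?thesis by (simp add: add.commute divide_right_mono)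
qed

text \<open>As \<open>\<bar>beta k\<bar> \<le> 1\<close>, extrapolation yields at most two copies of
  the new disagreement and one of the old. The factor 3 gained from \<open>ln 3\<close> in
  \<open>tau_y\<close> compensates for these three terms.\<close>

lemma disagreement_y_Suc:
  "disagreement N (y (Suc k))
    \<le> (2 * disagreement N (x (Suc k)) + disagreement N (x k)) / (3 * (real k + 1)\<^sup>2)"
proof -
  let ?D = "disagreement N (\<lambda>j. x (Suc k) j - x k j)"
  let ?z = "\<lambda>j. x (Suc k) j + beta k *\<^sub>R (x (Suc k) j - x k j)"
  have "disagreement N (y (Suc k)) \<le> mu N W ^ tau_y (mu N W) (Suc k) * disagreement N ?z"
    using disagreement_cong[of N "y (Suc k)", OF y_Suc]
      disagreement_mix_pow[OF N_pos stochastic less_imp_le[OF mu_pos]] by simp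
  also have "\<dots> \<le> 1 / (3 * (real (Suc k))\<^sup>2) * disagreement N ?z"
    using mu_pos mu_less_1 by (intro mult_right_mono mu_pow_tau_y disagreement_nonneg) auto
  also have "disagreement N ?z \<le> 2 * disagreement N (x (Suc k)) + disagreement N (x k)"
  proof -
    have "\<bar>beta k\<bar> * ?D \<le> 1 * ?D"
      by (intro mult_right_mono disagreement_nonneg) (simp add: beta_def)
    then show ?thesis
      using disagreement_add[of N "x (Suc k)" "\<lambda>j. beta k *\<^sub>R (x (Suc k) j - x k j)"]
        disagreement_diff[of N "x (Suc k)" "x k"] by (simp add: disagreement_scaleR)
  qed
  finally show ?thesis by (simp add: add.commute divide_right_mono)
qed

lemma disagreement_le_B: "disagreement N (x k) \<le> B \<and> disagreement N (y k) \<le> B"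
proof (induction k)
  case 0
  then show ?case using disagreement_0 B_nonneg by simp
next
  case (Suc k)
  \<comment> \<open>At \<open>k = 0\<close> the contraction factor is 1 and the bound comes from the
    common starting point; from \<open>k = 1\<close> on the factor is at most \<open>1 / 4\<close>,
    which outweighs the sum \<open>2 * B\<close>.\<close>
  have X: "disagreement N (x (Suc k)) \<le> B"
  proof (cases "k = 0")
    case True
    then show ?thesis using disagreement_x_Suc[of 0] disagreement_0 by simp
  next
    case False
    then have "2\<^sup>2 \<le> (real k + 1)\<^sup>2" by (intro power_mono) auto
    then have "2 * B \<le> B * (real k + 1)\<^sup>2"
      using B_nonneg mult_left_mono[of 2 "(real k + 1)\<^sup>2" B] by (simp add: mult.commute)
    then have "(disagreement N (y k) + B) / (real k + 1)\<^sup>2 \<le> B"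
      using Suc by (simp add: divide_le_eq)
    then show ?thesis using disagreement_x_Suc[of k] by linarith
  qed
  have "1\<^sup>2 \<le> (real k + 1)\<^sup>2" by (intro power_mono) auto
  then have "3 * B \<le> B * (3 * (real k + 1)\<^sup>2)"
    using B_nonneg mult_left_mono[of 1 "(real k + 1)\<^sup>2" B] by simp
  then have "(2 * disagreement N (x (Suc k)) + disagreement N (x k)) / (3 * (real k + 1)\<^sup>2) \<le> B"
    using Suc X by (simp add: divide_le_eq)
  then show ?case using X disagreement_y_Suc[of k] by linarith
qed

text \<open>Feeding the uniform bound \<open>B\<close> back into the one-step estimate turns
  boundedness into decay.\<close>

lemma disagreement_x_le:
  assumes "1 \<le> k"
  shows "disagreement N (x k) \<le> 2 * B / (real k)\<^sup>2"
proof -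
  obtain j where k: "k = Suc j" using assms by (cases k) auto
  have "disagreement N (x k) \<le> (disagreement N (y j) + B) / (real k)\<^sup>2"
    using disagreement_x_Suc[of j] by (simp add: k add.commute)
  also have "\<dots> \<le> 2 * B / (real k)\<^sup>2"
    using disagreement_le_B[of j] by (intro divide_right_mono) auto
  finally show ?thesis .
qed

lemma disagreement_y_le:
  assumes "1 \<le> k"
  shows "disagreement N (y k) \<le> B / (real k)\<^sup>2"
proof -
  obtain j where k: "k = Suc j" using assms by (cases k) auto
  have "disagreement N (y k)
      \<le> (2 * disagreement N (x k) + disagreement N (x j)) / (3 * (real k)\<^sup>2)"
    using disagreement_y_Suc[of j] by (simp add: k add.commute)
  also have "\<dots> \<le> 3 * B / (3 * (real k)\<^sup>2)"
    using disagreement_le_B[of j] disagreement_le_B[of k] by (intro divide_right_mono) auto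
  finally show ?thesis by simp
qed

section \<open>The averages as an inexact oracle\<close>

lemma model_at:
  "model k + gbar k \<bullet> (z - ybar k) = (\<Sum>i<N. f i (y k i) + grad i (y k i) \<bullet> (z - y k i)) / real N"
proof -
  have "gbar k \<bullet> (z - ybar k) = (\<Sum>i<N. grad i (y k i) \<bullet> (z - ybar k)) / real N"
    by (simp add: gbar_def node_average_def inner_sum_left)
  then show ?thesis
    by (simp add: model_def inner_diff_right flip: add_divide_distrib sum.distrib)
qed

lemma model_lower:
  assumes "z \<in> Rn d"
  shows "model k + gbar k \<bullet> (z - ybar k) \<le> mean_cost z"
  unfolding model_at mean_cost_def total_cost_def
  using convex_gradient_lower[OF subspace_Rn y_in_Rn assms convex has_gradient]
  by (intro divide_right_mono sum_mono) auto

text \<open>The local descent inequalities are summed, and the squared distances to the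
  \<open>y k i\<close> split into \<open>N\<close> times the squared distance to
  \<open>ybar k\<close> plus the squared disagreement; the latter is the oracle error.\<close>

lemma model_upper:
  assumes "z \<in> Rn d"
  shows "mean_cost z \<le> model k + gbar k \<bullet> (z - ybar k) + L / 2 * (norm (z - ybar k))\<^sup>2
    + L / (2 * real N) * (disagreement N (y k))\<^sup>2"
proof -
  have "total_cost N f z
      \<le> (\<Sum>i<N. f i (y k i) + grad i (y k i) \<bullet> (z - y k i) + L / 2 * (norm (z - y k i))\<^sup>2)"
    unfolding total_cost_def
    using smooth_upper[OF subspace_Rn y_in_Rn assms lipschitz has_gradient]
    by (intro sum_mono) auto
  also have "\<dots> = (\<Sum>i<N. f i (y k i) + grad i (y k i) \<bullet> (z - y k i))
      + L / 2 * (real N * (norm (z - ybar k))\<^sup>2 + (disagreement N (y k))\<^sup>2)"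
    unfolding ybar_def sum_norm_minus_node_average[OF N_pos, symmetric]
    by (simp add: sum.distrib sum_distrib_left)
  finally show ?thesis
    using N_pos unfolding model_at mean_cost_def by (simp add: field_simps)
qed

lemma mean_cost_minimal: "z \<in> Rn d \<Longrightarrow> mean_cost xstar \<le> mean_cost z"
  unfolding mean_cost_def using minimal by (intro divide_right_mono) auto

text \<open>Expanding around \<open>v\<close> at \<open>z\<close> and at its reflection \<open>2 v - z\<close> cancels the gradient term.\<close>

lemma mean_cost_near:
  assumes "v \<in> Rn d" "z \<in> Rn d"
  shows "mean_cost z - mean_cost xstar
    \<le> 2 * (mean_cost v - mean_cost xstar) + L * (norm (z - v))\<^sup>2"
proof -
  define w where "w = 2 *\<^sub>R v - z"
  have w: "w \<in> Rn d" unfolding w_def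
    using assms by (intro subspace_diff subspace_scale subspace_Rn)
  have wv: "w - v = - (z - v)" by (simp add: w_def scaleR_2)
  have "f i z + f i w \<le> 2 * f i v + L * (norm (z - v))\<^sup>2" if i: "i < N" for i
    using smooth_upper[OF subspace_Rn assms lipschitz[OF i] has_gradient[OF i]]
      smooth_upper[OF subspace_Rn assms(1) w lipschitz[OF i] has_gradient[OF i]]
    unfolding wv inner_minus_right norm_minus_cancel by simp
  then have "(\<Sum>i<N. f i z + f i w) \<le> (\<Sum>i<N. 2 * f i v + L * (norm (z - v))\<^sup>2)"
    by (intro sum_mono) auto
  then have "total_cost N f z + total_cost N f w
      \<le> 2 * total_cost N f v + real N * (L * (norm (z - v))\<^sup>2)"
    by (simp add: total_cost_def sum.distrib sum_distrib_left)
  then have "(total_cost N f z + total_cost N f w) / real N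
      \<le> (2 * total_cost N f v + real N * (L * (norm (z - v))\<^sup>2)) / real N"
    by (rule divide_right_mono) simp
  then have "mean_cost z + mean_cost w \<le> 2 * mean_cost v + L * (norm (z - v))\<^sup>2"
    using N_pos by (simp add: mean_cost_def add_divide_distrib)
  \<comment> \<open>Minimality bounds the cost at the reflected point from below by the optimal
    value.\<close>
  then show ?thesis using mean_cost_minimal[OF w] by simp
qed

section \<open>Convergence rates\<close>

lemma oracle_error_sum:
  "(\<Sum>s<k. (real s + 2)\<^sup>2 / 4 * (L / (2 * real N) * (disagreement N (y s))\<^sup>2))
    \<le> 9 / 4 * L * \<alpha>\<^sup>2 * G\<^sup>2"
proof -
  have "(real s + 2)\<^sup>2 / 4 * (L / (2 * real N) * (disagreement N (y s))\<^sup>2)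
      \<le> 9 / 8 * L * \<alpha>\<^sup>2 * G\<^sup>2 * (1 / (real s)\<^sup>2)" for s
  proof (cases "s = 0")
    case True
    then show ?thesis using disagreement_0 by simp
  next
    case False
    \<comment> \<open>Here \<open>s \<ge> 1\<close> gives \<open>s + 2 \<le> 3 * s\<close>. After
      inserting \<open>B\<close>, the factor \<open>N\<close> in \<open>B\<^sup>2\<close> cancels
      the \<open>1 / N\<close> of the oracle error, so the bound is uniform in \<open>N\<close> and
      summable in \<open>s\<close>.\<close>
    have "(real s + 2)\<^sup>2 \<le> (3 * real s)\<^sup>2" using False by (intro power_mono) auto
    moreover have "(disagreement N (y s))\<^sup>2 \<le> (B / (real s)\<^sup>2)\<^sup>2"
      using disagreement_y_le[of s] False by (intro power_mono disagreement_nonneg) auto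
    ultimately have "(real s + 2)\<^sup>2 / 4 * (L / (2 * real N) * (disagreement N (y s))\<^sup>2)
        \<le> (3 * real s)\<^sup>2 / 4 * (L / (2 * real N) * (B / (real s)\<^sup>2)\<^sup>2)"
      using L_nonneg by (intro mult_mono divide_right_mono) auto
    also have "\<dots> = 9 / 8 * L * \<alpha>\<^sup>2 * G\<^sup>2 * (1 / (real s)\<^sup>2)"
      using False N_pos by (simp add: B_def power_mult_distrib power_divide field_simps)
    finally show ?thesis .
  qed
  then have "(\<Sum>s<k. (real s + 2)\<^sup>2 / 4 * (L / (2 * real N) * (disagreement N (y s))\<^sup>2))
      \<le> (\<Sum>s<k. 9 / 8 * L * \<alpha>\<^sup>2 * G\<^sup>2 * (1 / (real s)\<^sup>2))"
    by (intro sum_mono)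
  also have "\<dots> \<le> 9 / 8 * L * \<alpha>\<^sup>2 * G\<^sup>2 * 2"
    unfolding sum_distrib_left[symmetric]
    using L_nonneg by (intro mult_left_mono sum_inverse_squares_le) auto
  also have "\<dots> = 9 / 4 * L * \<alpha>\<^sup>2 * G\<^sup>2" by simp
  finally show ?thesis .
qed

text \<open>The averages satisfy the hypotheses of \<open>inexact_nesterov\<close>: the step-size
  condition gives \<open>L / 2 \<le> 1 / (2 * \<alpha>)\<close>, and the accumulated error is
  bounded by \<open>oracle_error_sum\<close>.\<close>

lemma mean_cost_xbar:
  assumes "1 \<le> k"
  shows "mean_cost (xbar k) - mean_cost xstar
    \<le> 4 * (R\<^sup>2 / (2 * \<alpha>) + 9 / 4 * L * \<alpha>\<^sup>2 * G\<^sup>2) / (real k)\<^sup>2"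
proof -
  have "L / 2 \<le> 1 / (2 * \<alpha>)"
    using step_le step_pos by (simp add: field_simps)
  then have "L / 2 * (norm (z - ybar k))\<^sup>2 \<le> 1 / (2 * \<alpha>) * (norm (z - ybar k))\<^sup>2" for z k
    by (rule mult_right_mono) simp
  then have upper: "mean_cost (xbar (Suc k)) \<le> model k + gbar k \<bullet> (xbar (Suc k) - ybar k)
      + 1 / (2 * \<alpha>) * (norm (xbar (Suc k) - ybar k))\<^sup>2
      + L / (2 * real N) * (disagreement N (y k))\<^sup>2" for k
    using model_upper[OF xbar_in_Rn, of "Suc k" k] by (smt (verit))
  have gap: "0 \<le> mean_cost (xbar k) - mean_cost xstar"
    using mean_cost_minimal xbar_in_Rn by simp
  have "(real k)\<^sup>2 / 4 * (mean_cost (xbar k) - mean_cost xstar)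
      \<le> real k * (real k + 2) / 4 * (mean_cost (xbar k) - mean_cost xstar)"
    using gap by (intro mult_right_mono) (auto simp: power2_eq_square field_simps)
  also have "\<dots> \<le> (norm (xbar 0 - xstar))\<^sup>2 / (2 * \<alpha>)
      + (\<Sum>s<k. (real s + 2)\<^sup>2 / 4 * (L / (2 * real N) * (disagreement N (y s))\<^sup>2))"
    by (rule inexact_nesterov[where l=model, OF step_pos ybar_0 xbar_Suc ybar_Suc model_lower
          model_lower upper mean_cost_minimal]) (rule xbar_in_Rn xstar)+
  also have "\<dots> \<le> R\<^sup>2 / (2 * \<alpha>) + 9 / 4 * L * \<alpha>\<^sup>2 * G\<^sup>2"
    using start step_pos
    by (intro add_mono oracle_error_sum divide_right_mono power_mono) (auto simp: xbar_def)
  finally show ?thesis using assms by (simp add: field_simps)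
qed

text \<open>Passing from the average to node \<open>i\<close> doubles the gap, which yields the
  constants \<open>4 = 2 * 4 / 2\<close> and \<open>18 = 2 * 4 * 9 / 4\<close>, and adds
  \<open>L\<close> times the squared deviation, of order \<open>N / k ^ 4\<close>.\<close>

lemma cost_bound:
  assumes "1 \<le> k" "i < N"
  shows "1 / real N * (total_cost N f (x k i) - total_cost N f xstar)
    \<le> (4 * R\<^sup>2 / \<alpha> + 18 * L * \<alpha>\<^sup>2 * G\<^sup>2) * rate_bound N (real k)"
proof -
  define C where "C = 4 * R\<^sup>2 / \<alpha> + 18 * L * \<alpha>\<^sup>2 * G\<^sup>2"
  have C: "4 * L * \<alpha>\<^sup>2 * G\<^sup>2 \<le> C" "0 \<le> C"
    using step_pos L_nonneg by (auto simp: C_def intro!: add_increasing mult_right_mono)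
  have "norm (x k i - xbar k) \<le> 2 * B / (real k)\<^sup>2"
    using norm_minus_node_average_le[OF assms(2), of "x k"] disagreement_x_le[OF assms(1)]
    by (simp add: xbar_def)
  then have "(norm (x k i - xbar k))\<^sup>2 \<le> (2 * B / (real k)\<^sup>2)\<^sup>2"
    by (rule power_mono) simp
  also have "\<dots> = 4 * \<alpha>\<^sup>2 * G\<^sup>2 * (real N / real k ^ 4)"
    by (simp add: B_def power_mult_distrib power_divide)
  finally have "L * (norm (x k i - xbar k))\<^sup>2 \<le> L * (4 * \<alpha>\<^sup>2 * G\<^sup>2 * (real N / real k ^ 4))"
    using L_nonneg by (rule mult_left_mono)
  also have "\<dots> = 4 * L * \<alpha>\<^sup>2 * G\<^sup>2 * (real N / real k ^ 4)" by simp
  also have "\<dots> \<le> C * (real N / real k ^ 4)"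
    using C by (intro mult_right_mono) auto
  finally have "L * (norm (x k i - xbar k))\<^sup>2 \<le> C * (real N / real k ^ 4)" .
  moreover have "2 * (mean_cost (xbar k) - mean_cost xstar) \<le> C * (1 / (real k)\<^sup>2)"
  proof -
    have "2 * (4 * (R\<^sup>2 / (2 * \<alpha>) + 9 / 4 * L * \<alpha>\<^sup>2 * G\<^sup>2) / (real k)\<^sup>2) = C * (1 / (real k)\<^sup>2)"
      by (simp add: C_def add_divide_distrib distrib_left)
    from this[symmetric] show ?thesis
      by (simp only:) (intro mult_left_mono mean_cost_xbar assms, simp)
  qed
  moreover have "0 \<le> C * (sqrt (real N) / real k ^ 3)"
    using C by simp
  ultimately show ?thesis
    using mean_cost_near[OF xbar_in_Rn[of k] x_in_Rn[OF assms(2), of k]]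
    by (simp add: mean_cost_def rate_bound_def C_def[symmetric] distrib_left diff_divide_distrib)
qed

lemma cost_bound_rounds:
  assumes "1 \<le> k" "i < N" "0 < \<xi>" "\<xi> < 1"
  shows "1 / real N * (total_cost N f (x k i) - total_cost N f xstar)
    \<le> (4 * R\<^sup>2 / \<alpha> + 18 * L * \<alpha>\<^sup>2 * G\<^sup>2) * (4 / \<xi>) ^ 4
      * rate_bound N ((1 - mu N W) * real (comm_rounds (mu N W) k) powr (1 - \<xi>))"
proof -
  let ?s = "(1 - mu N W) * real (comm_rounds (mu N W) k) powr (1 - \<xi>)"
  have "0 < ?s"
    using comm_rounds_pos[OF mu_pos mu_less_1 assms(1)] mu_less_1 by simp
  then have "rate_bound N (real k) \<le> (4 / \<xi>) ^ 4 * rate_bound N ?s"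
    by (rule rate_bound_mono)
      (use scaled_comm_rounds_le[OF mu_pos mu_less_1 assms(1,3,4)] assms in auto)
  moreover have "0 \<le> 4 * R\<^sup>2 / \<alpha> + 18 * L * \<alpha>\<^sup>2 * G\<^sup>2"
    using step_pos L_nonneg by simp
  ultimately show ?thesis
    using cost_bound[OF assms(1,2)] mult_left_mono order_trans by (fastforce simp: mult.assoc)
qed

end

theorem theorem9:
  fixes L G R \<alpha> \<xi> :: real
  assumes "0 \<le> L" and "0 < \<alpha>" and "L \<noteq> 0 \<longrightarrow> \<alpha> \<le> 1 / (2 * L)"
    and "0 < \<xi>" and "\<xi> < 1"
  shows "\<exists>C1 C2 :: real.
    \<forall>(N :: nat) (d :: nat) (E :: nat set set) (W :: nat \<Rightarrow> nat \<Rightarrow> real)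
      (f :: nat \<Rightarrow> rvec \<Rightarrow> real) (grad :: nat \<Rightarrow> rvec \<Rightarrow> rvec) (xstar :: rvec)
      (x :: nat \<Rightarrow> nat \<Rightarrow> rvec) (y :: nat \<Rightarrow> nat \<Rightarrow> rvec).
      2 \<le> N \<and> 1 \<le> d \<and>
      simple_graph N E \<and> connected_graph N E \<and> weight_matrix N E W \<and>
      0 < mu N W \<and> mu N W < 1 \<and>
      (\<forall>i<N. convex_on (Rn d) (f i) \<and>
             is_gradient_on d (f i) (grad i) \<and>
             L-lipschitz_on (Rn d) (grad i) \<and>
             (\<forall>z\<in>Rn d. norm (grad i z) \<le> G)) \<and>
      xstar \<in> Rn d \<and> (\<forall>z\<in>Rn d. total_cost N f xstar \<le> total_cost N f z) \<and>
      dnc_run N W d grad \<alpha> x y \<and>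
      norm (node_average N (x 0) - xstar) \<le> R
      \<longrightarrow>
      (\<forall>k\<ge>1. \<forall>i<N.
        1 / real N * (total_cost N f (x k i) - total_cost N f xstar)
          \<le> C1 * rate_bound N
                ((1 - mu N W) * real (comm_rounds (mu N W) k) powr (1 - \<xi>)) \<and>
        1 / real N * (total_cost N f (x k i) - total_cost N f xstar)
          \<le> C2 * rate_bound N (real k))"
proof (intro exI allI impI, elim conjE, intro conjI)
  \<comment> \<open>The witnesses for \<open>C1\<close> and \<open>C2\<close> are still schematic
    here and are set by the two final claims. Having been introduced before the network, they can
    depend only on the parameters fixed in the theorem.\<close>
  let ?C = "4 * R\<^sup>2 / \<alpha> + 18 * L * \<alpha>\<^sup>2 * G\<^sup>2"
  fix N d :: nat and E :: "nat set set" and W f grad xstar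
    and x y :: "nat \<Rightarrow> nat \<Rightarrow> rvec" and k i :: nat
  assume "2 \<le> N" "weight_matrix N E W" "0 < mu N W" "mu N W < 1"
    and "\<forall>i<N. convex_on (Rn d) (f i) \<and> is_gradient_on d (f i) (grad i) \<and>
      L-lipschitz_on (Rn d) (grad i) \<and> (\<forall>z\<in>Rn d. norm (grad i z) \<le> G)"
    and "xstar \<in> Rn d" "\<forall>z\<in>Rn d. total_cost N f xstar \<le> total_cost N f z"
    and "dnc_run N W d grad \<alpha> x y" "norm (node_average N (x 0) - xstar) \<le> R"
    and ki: "1 \<le> k" "i < N"
  then interpret dnc N d W f grad xstar x y L G R \<alpha>
    using assms(1-3) by unfold_locales (auto simp: weight_matrix_def field_simps)
  show "1 / real N * (total_cost N f (x k i) - total_cost N f xstar)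
      \<le> ?C * (4 / \<xi>) ^ 4
        * rate_bound N ((1 - mu N W) * real (comm_rounds (mu N W) k) powr (1 - \<xi>))"
    by (rule cost_bound_rounds[OF ki assms(4,5)])
  show "1 / real N * (total_cost N f (x k i) - total_cost N f xstar) \<le> ?C * rate_bound N (real k)"
    by (rule cost_bound[OF ki])
qed

end
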